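(* Let $X$ be an inf-semilattice and $\Lambda$ a totally ordered set, and assume that both $X$ and $\Lambda$ are topological inf-semilattices for which intervals are compact. Let $u:X\to\Lambda$ be a function with closed and lower bounded upper level sets, that is, all the sets $\{x\in X:u(x)\geqslant\lambda\}$, $\lambda\in\Lambda$, are closed and bounded below in $X$. Then $u$ is a regular quasi-Leontief function if and only if, for all $x_1,x_2\in X$, $u(x_1\wedge x_2)=\min\{u(x_1),u(x_2)\}$.
   Context: An inf-semilattice is a partially ordered set in which any two elements $x_1,x_2$ have a greatest lower bound, written $x_1\wedge x_2$; a topological inf-semilattice is an inf-semilattice equipped with a topology for which the map $(x_1,x_2)\mapsto x_1\wedge x_2$ is continuous. A totally ordered set is an inf-semilattice. Intervals are the sets $[x_1,x_2]=\{x:x_1\leqslant x\leqslant x_2\}$. $u:X\to\Lambda$ is quasi-Leontief if for every $x\in X$ there is $x^\circ\in X$ with $\{x'\in X:u(x')\geqslant u(x)\}=\{x'\in X:x'\geqslant x^\circ\}$. A quasi-Leontief function $u$ is regular if for every $\lambda\in\Lambda$ the set $\{x\in X:u(x)\geqslant\lambda\}$ is either empty or has a smallest element.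
   Formalization: The intervals of X are assumed compact and Hausdorff; if compact means only that every open cover has a finite subcover, the claim fails (X = {0} ∪ (1,2] with the down-sets open, u = 0 at 0 and 1 elsewhere). *)

theory Defs
  imports "HOL-Analysis.Analysis"
begin

definition quasi_Leontief :: "('a::order \<Rightarrow> 'b::linorder) \<Rightarrow> bool" where
  "quasi_Leontief u \<longleftrightarrow> (\<forall>x. \<exists>x0. {x'. u x' \<ge> u x} = {x'. x' \<ge> x0})"

definition regular_quasi_Leontief :: "('a::order \<Rightarrow> 'b::linorder) \<Rightarrow> bool" where
  "regular_quasi_Leontief u \<longleftrightarrow> quasi_Leontief u \<and>
     (\<forall>l. {x. u x \<ge> l} = {} \<or> (\<exists>m \<in> {x. u x \<ge> l}. \<forall>y \<in> {x. u x \<ge> l}. m \<le> y))"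

text \<open>
  Compactness of an interval is \<^const>\<open>compact\<close> (every open cover has a finite subcover), which
  does not include separation. Some separation is needed on the domain: let \<open>X = {0} \<union> (1,2]\<close> with
  the usual order and the down-sets as open sets, and let \<open>u\<close> be \<open>0\<close> at \<open>0\<close> and \<open>1\<close> elsewhere. Then
  the meet is continuous, intervals are quasi-compact, the upper level sets are closed and bounded
  below and \<open>u\<close> preserves meets, but \<open>{x. u x \<ge> 1} = (1,2]\<close> has no smallest element.
  The following condition is implied both by the convention that topological spaces are Hausdorff
  and by the convention that compact sets are Hausdorff.
\<close>

definition Hausdorff_intervals :: "'a::{order, topological_space} itself \<Rightarrow> bool" where
  "Hausdorff_intervals _ \<longleftrightarrow> (\<forall>a b :: 'a. Hausdorff_space (top_of_set {a..b}))"

end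

theory Submission
  imports Defs
begin

text \<open>
  Only the direction from meet preservation to regularity uses topology. An upper level set \<open>S\<close>
  containing \<open>s\<close> and bounded below by \<open>b\<close> is then closed under meets, so the sets \<open>S \<inter> {b..y}\<close>
  with \<open>y \<in> S \<inter> {b..s}\<close> have the finite intersection property. They are closed in the compact
  Hausdorff interval \<open>{b..s}\<close>, and a common point is the smallest element of \<open>S\<close>, because every
  \<open>y \<in> S\<close> lies above \<open>inf y s \<in> S \<inter> {b..s}\<close>.
\<close>

text \<open>The upper level set at \<open>u x\<close> is a principal up-set containing
  \<open>x\<close>, hence contains everything above \<open>x\<close>.\<close>

lemma quasi_Leontief_mono:
  assumes "quasi_Leontief u"
  shows "mono u"
proof
  fix x y :: 'a
  assume "x \<le> y"
  obtain x0 where x0: "{x'. u x' \<ge> u x} = {x'. x' \<ge> x0}"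
    using assms unfolding quasi_Leontief_def by blast
  from x0 have "x0 \<le> x"
    by blast
  with \<open>x \<le> y\<close> have "y \<in> {x'. x' \<ge> x0}"
    by auto
  with x0 show "u x \<le> u y"
    by blast
qed

text \<open>For monotone \<open>u\<close>, a level set with least element \<open>m\<close> is the
  whole up-set of \<open>m\<close>. The quasi-Leontief condition is thus the case
  \<open>l = u x\<close> of having least elements.\<close>

lemma regular_quasi_Leontief_iff:
  "regular_quasi_Leontief u \<longleftrightarrow>
     mono u \<and> (\<forall>l. {x. u x \<ge> l} \<noteq> {} \<longrightarrow> (\<exists>m. u m \<ge> l \<and> (\<forall>y. u y \<ge> l \<longrightarrow> m \<le> y)))"
proof -
  have "quasi_Leontief u"
    if "mono u" and least: "\<forall>l. {x. u x \<ge> l} \<noteq> {} \<longrightarrow> (\<exists>m. u m \<ge> l \<and> (\<forall>y. u y \<ge> l \<longrightarrow> m \<le> y))"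
    unfolding quasi_Leontief_def
  proof
    fix x
    obtain m where "u m \<ge> u x" "\<forall>y. u y \<ge> u x \<longrightarrow> m \<le> y"
      using least by blast
    then have "{x'. u x' \<ge> u x} = {x'. x' \<ge> m}"
      by (auto intro: order_trans[OF _ monoD[OF \<open>mono u\<close>]])
    then show "\<exists>x0. {x'. u x' \<ge> u x} = {x'. x' \<ge> x0}" ..
  qed
  then show ?thesis
    unfolding regular_quasi_Leontief_def using quasi_Leontief_mono[of u] by auto
qed

lemma Inf_fin_mem:
  fixes S :: "'a::semilattice_inf set"
  assumes "finite F" "F \<noteq> {}" "F \<subseteq> S"
    and "\<And>x y. x \<in> S \<Longrightarrow> y \<in> S \<Longrightarrow> inf x y \<in> S"
  shows "Inf_fin F \<in> S"
  using assms(1-3) by (induction F rule: finite_ne_induct) (auto intro: assms(4))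

lemma closed_inf_closed_has_least:
  fixes S :: "'a::{semilattice_inf, topological_space} set"
  assumes compact: "\<And>a b :: 'a. compact {a..b}"
    and Hausdorff: "Hausdorff_intervals TYPE('a)"
    and "closed S" "bdd_below S" "S \<noteq> {}"
    and inf_S: "\<And>x y. x \<in> S \<Longrightarrow> y \<in> S \<Longrightarrow> inf x y \<in> S"
  obtains m where "m \<in> S" "\<And>y. y \<in> S \<Longrightarrow> m \<le> y"
proof -
  obtain s where s: "s \<in> S"
    using \<open>S \<noteq> {}\<close> by blast
  obtain b where b: "\<And>y. y \<in> S \<Longrightarrow> b \<le> y"
    using \<open>bdd_below S\<close> unfolding bdd_below_def by blast
  let ?X = "top_of_set {b..s}"
  let ?C = "S \<inter> {b..s}"
  \<comment> \<open>Since \<open>s\<close> is one of the indices, any common point of the family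
    lies in \<open>S\<close>.\<close>
  have sC: "s \<in> ?C"
    using s b by simp
  have "compact_space ?X"
    using compact by (simp add: compact_space_subtopology)
  moreover have "closedin ?X (S \<inter> {b..y})" if "y \<in> ?C" for y
  proof -
    \<comment> \<open>The order is not assumed closed, so this comes from compactness of
      \<open>{b..y}\<close> inside the Hausdorff interval \<open>{b..s}\<close>.\<close>
    have "closedin ?X {b..y}"
    proof (rule compactin_imp_closedin)
      show "Hausdorff_space ?X"
        using Hausdorff unfolding Hausdorff_intervals_def by blast
      show "compactin ?X {b..y}"
        using that compact by (auto simp: compactin_subtopology)
    qed
    moreover have "closedin ?X ?C"
      using \<open>closed S\<close> by (metis closedin_closed_Int inf_commute)
    ultimately have "closedin ?X (?C \<inter> {b..y})"
      by (rule closedin_Int[rotated])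
    moreover have "?C \<inter> {b..y} = S \<inter> {b..y}"
      using that by auto
    ultimately show ?thesis
      by simp
  qed
  moreover have "\<Inter>\<F> \<noteq> {}" if \<F>: "finite \<F>" "\<F> \<subseteq> (\<lambda>y. S \<inter> {b..y}) ` ?C" for \<F>
  proof -
    obtain F where F: "finite F" "F \<subseteq> ?C" "\<F> = (\<lambda>y. S \<inter> {b..y}) ` F"
      using finite_subset_image[OF \<F>] by metis
    \<comment> \<open>Inserting \<open>s\<close> keeps the set nonempty, as \<open>Inf_fin\<close>
      requires, even if \<open>F\<close> is empty.\<close>
    have "Inf_fin (insert s F) \<in> S"
      using F s inf_S by (intro Inf_fin_mem) auto
    moreover have "Inf_fin (insert s F) \<le> y" if "y \<in> F" for y
      using F that by (intro Inf_fin.coboundedI) auto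
    ultimately have "Inf_fin (insert s F) \<in> \<Inter>\<F>"
      using F(3) b by auto
    then show ?thesis
      by blast
  qed
  ultimately have "\<Inter>((\<lambda>y. S \<inter> {b..y}) ` ?C) \<noteq> {}"
    unfolding compact_space_fip by (elim allE[where x = "(\<lambda>y. S \<inter> {b..y}) ` ?C"] mp) simp_all
  then obtain m where m: "\<And>y. y \<in> ?C \<Longrightarrow> m \<in> S \<inter> {b..y}"
    by (auto simp only: INT_iff simp flip: ex_in_conv)
  show thesis
  proof
    show "m \<in> S"
      using m[OF sC] by blast
    show "m \<le> y" if "y \<in> S" for y
    proof -
      have "inf y s \<in> ?C"
        using inf_S[OF that s] b[OF that] b[OF s] by simp
      then have "m \<le> inf y s"
        using m by (meson IntE atLeastAtMost_iff)
      then show ?thesis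
        by simp
    qed
  qed
qed

theorem proposition2p3p3:
  fixes u :: "'a::{semilattice_inf, topological_space} \<Rightarrow> 'b::{linorder, topological_space}"
  assumes "continuous_on UNIV (\<lambda>p :: 'a \<times> 'a. inf (fst p) (snd p))"
    and "continuous_on UNIV (\<lambda>p :: 'b \<times> 'b. min (fst p) (snd p))"
    and "\<And>a b :: 'a. compact {a..b}"
    and "\<And>a b :: 'b. compact {a..b}"
    and "Hausdorff_intervals TYPE('a)"
    and "\<And>l. closed {x. u x \<ge> l}"
    and "\<And>l. bdd_below {x. u x \<ge> l}"
  shows "regular_quasi_Leontief u \<longleftrightarrow> (\<forall>x1 x2. u (inf x1 x2) = min (u x1) (u x2))"
proof
  assume "regular_quasi_Leontief u"
  then have "mono u"
    and least: "\<And>l x. u x \<ge> l \<Longrightarrow> \<exists>m. u m \<ge> l \<and> (\<forall>y. u y \<ge> l \<longrightarrow> m \<le> y)"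
    unfolding regular_quasi_Leontief_iff by blast+
  show "\<forall>x1 x2. u (inf x1 x2) = min (u x1) (u x2)"
  proof (intro allI antisym)
    fix x1 x2
    show "u (inf x1 x2) \<le> min (u x1) (u x2)"
      using \<open>mono u\<close> by (simp add: monoD)
    \<comment> \<open>At the level \<open>min (u x1) (u x2)\<close> both points belong to the level
      set, so its least element \<open>m\<close> lies below their meet.\<close>
    obtain m where "u m \<ge> min (u x1) (u x2)" "m \<le> x1" "m \<le> x2"
      using least[of "min (u x1) (u x2)" x1] by auto
    moreover from this have "u m \<le> u (inf x1 x2)"
      using \<open>mono u\<close> by (simp add: monoD)
    ultimately show "min (u x1) (u x2) \<le> u (inf x1 x2)"
      by order
  qed
next
  assume meet: "\<forall>x1 x2. u (inf x1 x2) = min (u x1) (u x2)"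
  \<comment> \<open>If \<open>x \<le> y\<close> then \<open>inf x y = x\<close>, so
    \<open>u x = min (u x) (u y)\<close>.\<close>
  have "mono u"
    by (rule monoI) (metis inf.absorb1 meet min.cobounded2)
  moreover have "\<exists>m. u m \<ge> l \<and> (\<forall>y. u y \<ge> l \<longrightarrow> m \<le> y)" if "{x. u x \<ge> l} \<noteq> {}" for l
  proof (rule closed_inf_closed_has_least[OF assms(3,5) assms(6,7)[of l] that])
    show "inf x y \<in> {x. u x \<ge> l}" if "x \<in> {x. u x \<ge> l}" "y \<in> {x. u x \<ge> l}" for x y
      using that meet by simp
  qed blast
  ultimately show "regular_quasi_Leontief u"
    unfolding regular_quasi_Leontief_iff by blast
qed

end
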